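(* Let $(X,d)$ be a compact metric space and let $f\colon X\to X$ be a continuous map which is chain transitive and has the s-limit shadowing property. If $h_{top}(f)>0$ (topological entropy), then for every integer $n\ge2$ there exists $\delta_n>0$ such that for every $D\in\mathcal{D}$, the set $D^n\cap\mathrm{DC1}_n^{\delta_n}(X,f)$ is a residual subset of $D^n$, i.e., contains a dense $G_\delta$-set of $D^n$.
   Context: Let $(X,d)$ be a compact metric space and $f\colon X\to X$ a continuous map. Chains. For $\delta>0$, a finite sequence $(x_i)_{i=0}^k$ in $X$ ($k$ a positive integer) is a $\delta$-chain of $f$ if $d(f(x_i),x_{i+1})\le\delta$ for every $0\le i\le k-1$. $f$ is chain transitive if for all $x,y\in X$ and $\delta>0$ there is a $\delta$-chain $(x_i)_{i=0}^k$ of $f$ with $x_0=x$ and $x_k=y$. The relation $\sim$ (for $f$ chain transitive). A $\delta$-chain $(x_i)_{i=0}^k$ with $x_0=x_k$ is a $\delta$-cycle of length $k$. Let $m=m(\delta)>0$ be the greatest common divisor of the lengths of all $\delta$-cycles of $f$. Define $x\sim_\delta y$ iff there is a $\delta$-chain $(x_i)_{i=0}^k$ of $f$ with $x_0=x$, $x_k=y$ and $m\mid k$; this is an equivalence relation on $X$. Define $x\sim y$ iff $x\sim_\delta y$ for every $\delta>0$; this is a closed equivalence relation on $X$. $\mathcal{D}$ denotes the set of equivalence classes of $\sim$. s-limit shadowing. For $\delta>0$, a sequence $(x_i)_{i\ge0}$ in $X$ is a $\delta$-limit-pseudo orbit of $f$ if $d(f(x_i),x_{i+1})\le\delta$ for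 all $i\ge0$ and $\lim_{i\to\infty}d(f(x_i),x_{i+1})=0$. It is $\epsilon$-limit shadowed by $x\in X$ if $d(f^i(x),x_i)\le\epsilon$ for all $i\ge0$ and $\lim_{i\to\infty}d(f^i(x),x_i)=0$. $f$ has the s-limit shadowing property if for every $\epsilon>0$ there is $\delta>0$ such that every $\delta$-limit-pseudo orbit of $f$ is $\epsilon$-limit shadowed by some point of $X$. Distributional scrambling. For $n\ge2$ and $\delta>0$, $\mathrm{DC1}_n^\delta(X,f)$ is the set of $(x_1,\dots,x_n)\in X^n$ such that $$\limsup_{m\to\infty}\frac1m\left|\{0\le k\le m-1\colon \max_{1\le i<j\le n}d(f^k(x_i),f^k(x_j))<\epsilon\}\right|=1\quad\text{for all }\epsilon>0,$$ and $$\limsup_{m\to\infty}\frac1m\left|\{0\le k\le m-1\colon \min_{1\le i<j\le n}d(f^k(x_i),f^k(x_j))>\delta\}\right|=1.$$ $D^n$ carries the product (subspace) topology. *)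

theory Defs
  imports "HOL-Analysis.Analysis"
begin

text \<open>The ambient compact metric space \<open>X\<close> is a type \<open>'a :: metric_space\<close> whose
  universe is assumed compact where that is needed.\<close>

subsection \<open>Chains and chain transitivity\<close>

text \<open>A chain \<open>(x\<^sub>0, \<dots>, x\<^sub>k)\<close> is given by its length \<open>k\<close> together with a function on
  \<open>nat\<close> of which only the values at \<open>0, \<dots>, k\<close> matter.\<close>

definition delta_chain :: "('a::metric_space \<Rightarrow> 'a) \<Rightarrow> real \<Rightarrow> nat \<Rightarrow> (nat \<Rightarrow> 'a) \<Rightarrow> bool" where
  "delta_chain f \<delta> k x \<longleftrightarrow> k > 0 \<and> (\<forall>i<k. dist (f (x i)) (x (Suc i)) \<le> \<delta>)"

definition chain_transitive :: "('a::metric_space \<Rightarrow> 'a) \<Rightarrow> bool" where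
  "chain_transitive f \<longleftrightarrow>
     (\<forall>x y. \<forall>\<delta>>0. \<exists>k z. delta_chain f \<delta> k z \<and> z 0 = x \<and> z k = y)"

definition delta_cycle :: "('a::metric_space \<Rightarrow> 'a) \<Rightarrow> real \<Rightarrow> nat \<Rightarrow> (nat \<Rightarrow> 'a) \<Rightarrow> bool" where
  "delta_cycle f \<delta> k x \<longleftrightarrow> delta_chain f \<delta> k x \<and> x 0 = x k"

definition cycle_gcd :: "('a::metric_space \<Rightarrow> 'a) \<Rightarrow> real \<Rightarrow> nat" where
  "cycle_gcd f \<delta> = Gcd {k. \<exists>x. delta_cycle f \<delta> k x}"

definition chain_rel_at :: "('a::metric_space \<Rightarrow> 'a) \<Rightarrow> real \<Rightarrow> 'a rel" where
  "chain_rel_at f \<delta> =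
     {(x, y). \<exists>k z. delta_chain f \<delta> k z \<and> z 0 = x \<and> z k = y \<and> cycle_gcd f \<delta> dvd k}"

definition chain_rel :: "('a::metric_space \<Rightarrow> 'a) \<Rightarrow> 'a rel" where
  "chain_rel f = {(x, y). \<forall>\<delta>>0. (x, y) \<in> chain_rel_at f \<delta>}"

definition chain_classes :: "('a::metric_space \<Rightarrow> 'a) \<Rightarrow> 'a set set" where
  "chain_classes f = UNIV // chain_rel f"

subsection \<open>The s-limit shadowing property\<close>

definition limit_pseudo_orbit :: "('a::metric_space \<Rightarrow> 'a) \<Rightarrow> real \<Rightarrow> (nat \<Rightarrow> 'a) \<Rightarrow> bool" where
  "limit_pseudo_orbit f \<delta> x \<longleftrightarrow>
     (\<forall>i. dist (f (x i)) (x (Suc i)) \<le> \<delta>) \<and>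
     (\<lambda>i. dist (f (x i)) (x (Suc i))) \<longlonglongrightarrow> 0"

definition limit_shadowed_by ::
    "('a::metric_space \<Rightarrow> 'a) \<Rightarrow> real \<Rightarrow> (nat \<Rightarrow> 'a) \<Rightarrow> 'a \<Rightarrow> bool" where
  "limit_shadowed_by f \<epsilon> x p \<longleftrightarrow>
     (\<forall>i. dist ((f ^^ i) p) (x i) \<le> \<epsilon>) \<and>
     (\<lambda>i. dist ((f ^^ i) p) (x i)) \<longlonglongrightarrow> 0"

definition s_limit_shadowing :: "('a::metric_space \<Rightarrow> 'a) \<Rightarrow> bool" where
  "s_limit_shadowing f \<longleftrightarrow>
     (\<forall>\<epsilon>>0. \<exists>\<delta>>0. \<forall>x. limit_pseudo_orbit f \<delta> x \<longrightarrow> (\<exists>p. limit_shadowed_by f \<epsilon> x p))"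

subsection \<open>Topological entropy\<close>

definition separated :: "('a::metric_space \<Rightarrow> 'a) \<Rightarrow> nat \<Rightarrow> real \<Rightarrow> 'a set \<Rightarrow> bool" where
  "separated f n \<epsilon> E \<longleftrightarrow>
     (\<forall>x\<in>E. \<forall>y\<in>E. x \<noteq> y \<longrightarrow> (\<exists>i<n. dist ((f ^^ i) x) ((f ^^ i) y) > \<epsilon>))"

text \<open>\<open>log_sep\<close> is the logarithm of the largest cardinality of an \<open>(n, \<epsilon>)\<close>-separated set.
  It is taken in \<open>ereal\<close>, so that no junk value arises if the cardinalities are unbounded;
  the empty set contributes \<open>ln 0 = 0\<close>, the same as a singleton.\<close>

definition log_sep :: "('a::metric_space \<Rightarrow> 'a) \<Rightarrow> nat \<Rightarrow> real \<Rightarrow> ereal" where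
  "log_sep f n \<epsilon> = (SUP E\<in>{E. finite E \<and> separated f n \<epsilon> E}. ereal (ln (real (card E))))"

text \<open>Bowen's definition. The exponential growth rate increases as \<open>\<epsilon>\<close> decreases, so the
  limit as \<open>\<epsilon> \<rightarrow> 0\<close> is the supremum over \<open>\<epsilon> > 0\<close>.\<close>

definition h_top :: "('a::metric_space \<Rightarrow> 'a) \<Rightarrow> ereal" where
  "h_top f = (SUP \<epsilon>\<in>{0<..}. limsup (\<lambda>n. log_sep f n \<epsilon> / ereal (real n)))"

subsection \<open>Distributional scrambling\<close>

text \<open>Here and below \<open>n\<close>-tuples are extensional functions on \<open>{..<n}\<close>, matching the points of
  \<^const>\<open>product_topology\<close>.\<close>

definition pair_dists ::
    "('a::metric_space \<Rightarrow> 'a) \<Rightarrow> nat \<Rightarrow> (nat \<Rightarrow> 'a) \<Rightarrow> nat \<Rightarrow> real set" where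
  "pair_dists f n x k = {dist ((f ^^ k) (x i)) ((f ^^ k) (x j)) | i j. i < j \<and> j < n}"

definition upper_density :: "(nat \<Rightarrow> bool) \<Rightarrow> ereal" where
  "upper_density P = limsup (\<lambda>m. ereal (real (card {k. k < m \<and> P k}) / real m))"

definition DC1 :: "nat \<Rightarrow> real \<Rightarrow> ('a::metric_space \<Rightarrow> 'a) \<Rightarrow> (nat \<Rightarrow> 'a) set" where
  "DC1 n \<delta> f = {x \<in> {..<n} \<rightarrow>\<^sub>E UNIV.
     (\<forall>\<epsilon>>0. upper_density (\<lambda>k. Max (pair_dists f n x k) < \<epsilon>) = 1) \<and>
     upper_density (\<lambda>k. Min (pair_dists f n x k) > \<delta>) = 1}"

subsection \<open>Residual sets\<close>

definition power_top :: "nat \<Rightarrow> 'a::topological_space set \<Rightarrow> (nat \<Rightarrow> 'a) topology" where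
  "power_top n D = product_topology (\<lambda>_. top_of_set D) {..<n}"

definition residual_in :: "'b topology \<Rightarrow> 'b set \<Rightarrow> bool" where
  "residual_in T S \<longleftrightarrow> S \<subseteq> topspace T \<and>
     (\<exists>G. gdelta_in T G \<and> T closure_of G = topspace T \<and> G \<subseteq> S)"

end

theory Submission
  imports Defs
begin

text \<open>
  The argument rests on two facts about a class \<open>D\<close> of the chain relation.

  First, for each \<open>z\<close> in \<open>D\<close> the set of points asymptotic to \<open>z\<close> is contained in \<open>D\<close> and dense in \<open>D\<close>
  (\<open>stable_set_closure\<close>). Indeed a point \<open>x\<close> of \<open>D\<close> can be joined to \<open>f\<^sup>L z\<close> by a chain of length exactly \<open>L\<close>
  for some \<open>L\<close>, because chains of all large multiples of the gcd of the cycle lengths are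
  available; continuing along the orbit of \<open>z\<close> gives a limit pseudo orbit, and a point that shadows it is
  near \<open>x\<close> and asymptotic to \<open>z\<close>. So for every tuple \<open>u\<close> in \<open>D\<^sup>n\<close> the tuples asymptotic to \<open>u\<close> are dense in \<open>D\<^sup>n\<close>.
  Taking \<open>u\<close> constant, eventual proximity holds on a dense set. If \<open>D\<^sup>n\<close> contains a tuple \<open>w\<close> whose
  coordinates stay at mutual distance at least \<open>\<eta>\<close> for all times, then eventual separation by \<open>\<eta> / 2\<close>
  holds on a dense set as well. A condition which is open at each time and eventually true on
  a dense set has upper density 1 on a dense \<open>G\<^sub>\<delta>\<close> set, and the Baire category theorem in the compact space
  \<open>D\<^sup>n\<close> combines countably many such conditions (\<open>residual_upper_density_one\<close>).

  Second, every orbit closure meets \<open>D\<close> (\<open>orbit_closure_meets_class\<close>). So the tuple \<open>w\<close> exists, with \<open>\<eta>\<close>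
  independent of \<open>D\<close>, once there are \<open>n\<close> orbits that are pairwise at positive distance as sets.
  These come from the entropy (\<open>separated_orbits\<close>): the exponentially many distinguishable orbit
  segments of length \<open>N\<close> are closed up to periodic pseudo orbits with periods at most \<open>N + K\<close>, and
  since a periodic sequence has no more shifts than its period, \<open>n\<close> of them can be chosen so that no
  shift of one stays close to another. They are then shadowed by true orbits.
\<close>

section \<open>Chains of prescribed length\<close>

text \<open>
  Chains with their length and end points visible; unlike \<^const>\<open>chain_rel_at\<close>, without a condition
  on the length.
\<close>

definition reach :: "('a::metric_space \<Rightarrow> 'a) \<Rightarrow> real \<Rightarrow> nat \<Rightarrow> 'a \<Rightarrow> 'a \<Rightarrow> bool" where
  "reach f \<delta> k x y \<longleftrightarrow> (\<exists>z. delta_chain f \<delta> k z \<and> z 0 = x \<and> z k = y)"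

lemma reach_pos: "reach f \<delta> k x y \<Longrightarrow> 0 < k"
  by (auto simp: reach_def delta_chain_def)

lemma reach_trans:
  assumes "reach f \<delta> k x y" "reach f \<delta> l y w"
  shows "reach f \<delta> (k + l) x w"
proof -
  obtain u v where u: "delta_chain f \<delta> k u" "u 0 = x" "u k = y"
    and v: "delta_chain f \<delta> l v" "v 0 = y" "v l = w"
    using assms by (auto simp: reach_def)
  define c where "c i = (if i < k then u i else v (i - k))" for i
  have "dist (f (c i)) (c (Suc i)) \<le> \<delta>" if "i < k + l" for i
  proof (cases "i < k")
    case True
    then have "c (Suc i) = u (Suc i)"
      using u v by (cases "Suc i = k") (auto simp: c_def)
    with True u show ?thesis by (auto simp: c_def delta_chain_def)
  next
    case False
    then have "Suc i - k = Suc (i - k)" "i - k < l" using that by auto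
    with False v show ?thesis by (auto simp: c_def delta_chain_def)
  qed
  moreover have "c 0 = x" "c (k + l) = w" "0 < k + l"
    using u v by (auto simp: c_def delta_chain_def)
  ultimately show ?thesis by (auto simp: reach_def delta_chain_def)
qed

text \<open>Only the first and the last point of a chain are moved. They can coincide with the two ends of
a single step, when the chain has length 1, and so both errors are added to \<open>\<delta>\<close>.\<close>

lemma reach_perturb:
  assumes "reach f \<delta> k x y" "dist (f x') (f x) \<le> \<eta>" "dist y y' \<le> \<theta>" "0 \<le> \<eta>" "0 \<le> \<theta>"
  shows "reach f (\<delta> + \<eta> + \<theta>) k x' y'"
proof -
  obtain u where u: "delta_chain f \<delta> k u" "u 0 = x" "u k = y"
    using assms by (auto simp: reach_def)
  define c where "c i = (if i = 0 then x' else if i = k then y' else u i)" for i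
  have "dist (f (c i)) (c (Suc i)) \<le> \<delta> + \<eta> + \<theta>" if "i < k" for i
  proof -
    have "dist (f (c i)) (f (u i)) \<le> \<eta>" "dist (u (Suc i)) (c (Suc i)) \<le> \<theta>"
      using assms u that by (auto simp: c_def)
    moreover have "dist (f (u i)) (u (Suc i)) \<le> \<delta>"
      using u that by (auto simp: delta_chain_def)
    ultimately show ?thesis by metric
  qed
  then show ?thesis
    using u by (auto simp: reach_def delta_chain_def c_def intro!: exI[of _ c])
qed

lemma reach_mono: "reach f \<delta> k x y \<Longrightarrow> \<delta> \<le> \<delta>' \<Longrightarrow> reach f \<delta>' k x y"
  by (force simp: reach_def delta_chain_def)

lemma reach_perturb_end:
  assumes "reach f (\<delta> / 2) k x y" "dist y y' \<le> \<delta> / 2"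
  shows "reach f \<delta> k x y'"
  using reach_perturb[OF assms(1) _ assms(2), of x 0] order_trans[OF zero_le_dist assms(2)]
  by simp

lemma reach_orbit:
  assumes "0 < k" "0 \<le> \<delta>" shows "reach f \<delta> k x ((f ^^ k) x)"
  using assms by (auto simp: reach_def delta_chain_def intro!: exI[of _ "\<lambda>i. (f ^^ i) x"])

lemma reach_orbit_extend:
  assumes "reach f \<delta> k x y" "0 \<le> \<delta>"
  shows "reach f \<delta> (k + j) x ((f ^^ j) y)"
  using assms reach_trans[OF assms(1) reach_orbit[of j \<delta> f y]] by (cases "j = 0") auto

lemma chain_transitive_reach:
  assumes "chain_transitive f" "0 < \<delta>"
  obtains k where "reach f \<delta> k x y"
  using assms unfolding chain_transitive_def reach_def by metis

lemma cycle_gcd_dvd: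
  assumes "reach f \<delta> k x x" shows "cycle_gcd f \<delta> dvd k"
  unfolding cycle_gcd_def
proof (rule Gcd_dvd)
  obtain z where "delta_chain f \<delta> k z" "z 0 = x" "z k = x"
    using assms by (auto simp: reach_def)
  then show "k \<in> {k. \<exists>x. delta_cycle f \<delta> k x}" by (auto simp: delta_cycle_def intro!: exI[of _ z])
qed

lemma cycle_gcd_pos:
  assumes "chain_transitive f" "0 < \<delta>" shows "0 < cycle_gcd f \<delta>"
proof -
  obtain k where k: "reach f \<delta> k undefined undefined"
    using chain_transitive_reach[OF assms] by metis
  then show ?thesis
    using cycle_gcd_dvd[OF k] reach_pos[OF k] by (metis dvd_pos_nat)
qed

section \<open>The chain relation and its classes\<close>

lemma chain_rel_at_iff:
  "(x, y) \<in> chain_rel_at f \<delta> \<longleftrightarrow> (\<exists>k. reach f \<delta> k x y \<and> cycle_gcd f \<delta> dvd k)"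
  by (auto simp: chain_rel_at_def reach_def)

lemma chain_rel_iff:
  "(x, y) \<in> chain_rel f \<longleftrightarrow> (\<forall>\<delta>>0. \<exists>k. reach f \<delta> k x y \<and> cycle_gcd f \<delta> dvd k)"
  by (auto simp: chain_rel_def chain_rel_at_iff)

lemma chain_rel_at_trans:
  assumes "(x, y) \<in> chain_rel_at f \<delta>" "(y, w) \<in> chain_rel_at f \<delta>"
  shows "(x, w) \<in> chain_rel_at f \<delta>"
  using assms reach_trans by (metis chain_rel_at_iff dvd_add)

lemma chain_rel_at_sym:
  assumes "chain_transitive f" "0 < \<delta>" "(x, y) \<in> chain_rel_at f \<delta>"
  shows "(y, x) \<in> chain_rel_at f \<delta>"
proof -
  obtain k where k: "reach f \<delta> k x y" "cycle_gcd f \<delta> dvd k"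
    using assms by (auto simp: chain_rel_at_iff)
  obtain l where l: "reach f \<delta> l y x" using chain_transitive_reach assms by metis
  have "cycle_gcd f \<delta> dvd k + l" using cycle_gcd_dvd[OF reach_trans[OF k(1) l]] .
  with k l show ?thesis by (metis chain_rel_at_iff dvd_add_right_iff)
qed

lemma cycle_gcd_antimono:
  assumes "\<delta> \<le> \<delta>'" shows "cycle_gcd f \<delta>' dvd cycle_gcd f \<delta>"
proof -
  have "delta_cycle f \<delta>' k x" if "delta_cycle f \<delta> k x" for k x
    using that assms by (force simp: delta_cycle_def delta_chain_def)
  then show ?thesis
    unfolding cycle_gcd_def by (intro Gcd_greatest Gcd_dvd) auto
qed

lemma chain_rel_at_mono:
  assumes "(x, y) \<in> chain_rel_at f \<delta>" "\<delta> \<le> \<delta>'"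
  shows "(x, y) \<in> chain_rel_at f \<delta>'"
  using assms cycle_gcd_antimono[OF assms(2), of f]
  by (meson chain_rel_at_iff reach_mono dvd_trans)

text \<open>A \<open>\<delta> / 2\<close>-cycle at \<open>x\<close> turns into a \<open>\<delta>\<close>-chain from \<open>x\<close> to \<open>y\<close> when its last point is moved.
The cycle itself is a \<open>\<delta>\<close>-cycle, so its length is a multiple of the gcd at scale \<open>\<delta>\<close>. Hence the classes
at a fixed scale are open, and therefore closed.\<close>

lemma chain_rel_at_near:
  assumes "chain_transitive f" "0 < \<delta>" "dist x y \<le> \<delta> / 2"
  shows "(x, y) \<in> chain_rel_at f \<delta>"
proof -
  obtain k where k: "reach f (\<delta> / 2) k x x"
    using chain_transitive_reach[of f "\<delta> / 2"] assms by auto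
  have "cycle_gcd f \<delta> dvd k"
    using dvd_trans[OF cycle_gcd_antimono cycle_gcd_dvd[OF k]] assms(2) by simp
  then show ?thesis
    using reach_perturb_end[OF k assms(3)] by (auto simp: chain_rel_at_iff)
qed

lemma chain_rel_trans:
  "(x, y) \<in> chain_rel f \<Longrightarrow> (y, w) \<in> chain_rel f \<Longrightarrow> (x, w) \<in> chain_rel f"
  unfolding chain_rel_def by (auto intro: chain_rel_at_trans)

lemma chain_rel_sym:
  "chain_transitive f \<Longrightarrow> (x, y) \<in> chain_rel f \<Longrightarrow> (y, x) \<in> chain_rel f"
  unfolding chain_rel_def by (auto intro: chain_rel_at_sym)

text \<open>The relation with \<open>y l\<close> is only required at each scale from some index on. This serves both for
closedness of the classes and for limits of points that are related to \<open>x\<close> at finer and finer scales.\<close>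

lemma chain_rel_limit:
  assumes "chain_transitive f" "y \<longlonglongrightarrow> w"
    and "\<And>\<delta>. 0 < \<delta> \<Longrightarrow> \<forall>\<^sub>F l in sequentially. (x, y l) \<in> chain_rel_at f \<delta>"
  shows "(x, w) \<in> chain_rel f"
proof -
  have "(x, w) \<in> chain_rel_at f \<delta>" if "0 < \<delta>" for \<delta>
  proof -
    have "\<forall>\<^sub>F l in sequentially. dist (y l) w < \<delta> / 2"
      using assms(2) that by (intro tendstoD) auto
    with assms(3)[OF that] have "\<forall>\<^sub>F l in sequentially. (x, w) \<in> chain_rel_at f \<delta>"
    proof eventually_elim
      case (elim l)
      then show ?case
        using chain_rel_at_near[OF assms(1) that, of "y l" w] chain_rel_at_trans by fastforce
    qed
    then show ?thesis by simp
  qed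
  then show ?thesis by (auto simp: chain_rel_def)
qed

lemma chain_rel_refl: "chain_transitive f \<Longrightarrow> (x, x) \<in> chain_rel f"
  by (simp add: chain_rel_def chain_rel_at_near)

lemma closed_chain_class:
  assumes "chain_transitive f" shows "closed (chain_rel f `` {x})"
  unfolding closed_sequential_limits
proof (intro allI impI, elim conjE)
  fix y w assume "\<forall>n. y n \<in> chain_rel f `` {x}" "y \<longlonglongrightarrow> w"
  then show "w \<in> chain_rel f `` {x}"
    using chain_rel_limit[OF assms, of y w x] by (auto simp: chain_rel_def)
qed

section \<open>Lengths of cycles\<close>

text \<open>The least positive difference \<open>d\<close> of two elements of \<open>S\<close> divides every element, because the
remainder modulo \<open>d\<close> of an element of \<open>S\<close> is again such a difference; hence \<open>d\<close> is the gcd. If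
\<open>b\<close> and \<open>b + d\<close> lie in \<open>S\<close> and \<open>b = d q\<close>, then \<open>d (u q + v) = (u - v) b + v (b + d)\<close> covers all
multiples of \<open>d\<close> from \<open>d q\<^sup>2\<close> on.\<close>

lemma additive_set_large_multiples:
  fixes S :: "nat set"
  assumes add: "\<And>a b. a \<in> S \<Longrightarrow> b \<in> S \<Longrightarrow> a + b \<in> S"
    and pos: "\<And>a. a \<in> S \<Longrightarrow> 0 < a" and ne: "S \<noteq> {}"
  obtains t0 where "\<And>t. t0 \<le> t \<Longrightarrow> Gcd S * t \<in> S"
proof -
  define H where "H = {d. 0 < d \<and> (\<exists>b\<in>S. b + d \<in> S)}"
  have mult: "k * a \<in> S" if "a \<in> S" "0 < k" for k a
    using that(2)
  proof (induction k)
    case (Suc k) then show ?case using add that by (cases "k = 0") auto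
  qed simp
  obtain s where s: "s \<in> S" using ne by auto
  have "s \<in> H" using s add pos by (auto simp: H_def)
  \<comment> \<open>\<open>H\<close> contains \<open>s = 2 s - s\<close>, so the least element exists.\<close>
  define d where "d = (LEAST d. d \<in> H)"
  have d: "d \<in> H" unfolding d_def using \<open>s \<in> H\<close> by (rule LeastI)
  then obtain b where b: "b \<in> S" "b + d \<in> S" and dpos: "0 < d" by (auto simp: H_def)
  have "d dvd a" if a: "a \<in> S" for a
  proof (rule ccontr)
    assume "\<not> d dvd a"
    then have r: "0 < a mod d" by (simp add: dvd_eq_mod_eq_0)
    define q where "q = a div d"
    \<comment> \<open>Both \<open>(q + 1) b + q d\<close> and \<open>(q + 1) b + a\<close> lie in \<open>S\<close>, at distance \<open>a mod d\<close>.\<close>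
    have "q * (b + d) + b \<in> S"
      using b add[of "q * (b + d)" b] mult[of "b + d" q] by (cases "q = 0") auto
    moreover have "Suc q * b + a \<in> S" using mult[of b "Suc q"] b a add by blast
    moreover have "q * (b + d) + b + a mod d = Suc q * b + a"
      unfolding q_def by (simp add: algebra_simps)
    ultimately have "a mod d \<in> H" using r unfolding H_def by (metis (mono_tags, lifting) mem_Collect_eq)
    then have "d \<le> a mod d" unfolding d_def by (rule Least_le)
    moreover have "a mod d < d" using dpos by simp
    ultimately show False by simp
  qed
  then have "d dvd Gcd S" by (intro Gcd_greatest) auto
  moreover have "Gcd S dvd d"
    using b by (metis Gcd_dvd dvd_add_right_iff)
  ultimately have deq: "Gcd S = d" by (simp add: dvd_antisym)
  obtain q where q: "b = d * q" using \<open>\<And>a. a \<in> S \<Longrightarrow> d dvd a\<close> b by blast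
  have qpos: "0 < q" using q pos[OF b(1)] by auto
  have "d * t \<in> S" if t: "q * q \<le> t" for t
  proof -
    define u v where "u = t div q" and "v = t mod q"
    have "v < q" "q \<le> u" using qpos t by (auto simp: u_def v_def less_eq_div_iff_mult_less_eq)
    then have uv: "0 < u - v" "u - v + v = u" by auto
    have "d * t = d * (u * q + v)" by (simp add: u_def v_def)
    also have "\<dots> = (u - v) * b + v * (b + d)"
      unfolding q using uv
      by (metis (no_types, opaque_lifting) add_mult_distrib add_mult_distrib2 add.assoc mult.commute
          mult.left_commute)
    also have "\<dots> \<in> S"
      using mult[OF b(1) uv(1)] mult[OF b(2), of v] add by (cases "v = 0") auto
    finally show ?thesis .
  qed
  then show thesis using that deq by blast
qed

text \<open>The lengths of the cycles through one point \<open>x\<close> are closed under addition, and their gcd is already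
the gcd of all cycle lengths: a cycle elsewhere can be inserted into a detour from \<open>x\<close> and back,
and the two lengths of the detour differ by the length of that cycle.\<close>

lemma reach_large_multiples:
  assumes "chain_transitive f" "0 < \<delta>" "(x, y) \<in> chain_rel_at f \<delta>"
  obtains t0 where "\<And>t. t0 \<le> t \<Longrightarrow> reach f \<delta> (cycle_gcd f \<delta> * t) x y"
proof -
  let ?m = "cycle_gcd f \<delta>"
  define S where "S = {k. reach f \<delta> k x x}"
  obtain s where s: "s \<in> S" using chain_transitive_reach assms unfolding S_def by blast
  have S: "a + b \<in> S" "0 < a" if "a \<in> S" "b \<in> S" for a b
    using that reach_trans reach_pos unfolding S_def by blast+
  have "Gcd S dvd c" if c: "delta_cycle f \<delta> c z" for c z
  proof -
    obtain k l where kl: "reach f \<delta> k x (z 0)" "reach f \<delta> l (z 0) x"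
      using chain_transitive_reach[OF assms(1,2)] by metis
    have c': "reach f \<delta> c (z 0) (z 0)" using c by (auto simp: reach_def delta_cycle_def)
    have "k + l \<in> S" "k + l + c \<in> S"
      using reach_trans[OF kl] reach_trans[OF reach_trans[OF kl(1) c'] kl(2)]
      by (auto simp: S_def add_ac)
    then show ?thesis by (metis Gcd_dvd dvd_add_right_iff)
  qed
  then have "Gcd S dvd ?m" unfolding cycle_gcd_def by (intro Gcd_greatest) auto
  moreover have "?m dvd Gcd S"
    by (intro Gcd_greatest) (auto simp: S_def intro: cycle_gcd_dvd)
  ultimately have "Gcd S = ?m" by (rule dvd_antisym)
  then obtain t0 where t0: "\<And>t. t0 \<le> t \<Longrightarrow> ?m * t \<in> S"
    using additive_set_large_multiples[of S] S s by (metis empty_iff)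
  obtain k where k: "reach f \<delta> (?m * k) x y"
    using assms(3) by (auto simp: chain_rel_at_iff)
  have "reach f \<delta> (?m * t) x y" if "t0 + k \<le> t" for t
  proof -
    have "?m * t = ?m * (t - k) + ?m * k"
      using that by (simp flip: distrib_left)
    then show ?thesis
      using reach_trans[OF _ k, of "?m * (t - k)" x] t0[of "t - k"] that by (simp add: S_def)
  qed
  then show thesis using that by blast
qed

section \<open>Iterates and limits\<close>

lemma continuous_on_funpow:
  fixes f :: "'a::topological_space \<Rightarrow> 'a"
  assumes "continuous_on UNIV f" shows "continuous_on UNIV (f ^^ k)"
proof (induction k)
  case (Suc k)
  then show ?case
    using continuous_on_compose2[OF assms Suc] by (simp add: comp_def)
qed simp

lemma tendsto_funpow:
  fixes f :: "'a::topological_space \<Rightarrow> 'a"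
  assumes "continuous_on UNIV f" "y \<longlonglongrightarrow> w"
  shows "(\<lambda>l. (f ^^ k) (y l)) \<longlonglongrightarrow> (f ^^ k) w"
  using continuous_on_tendsto_compose[OF continuous_on_funpow[OF assms(1)] assms(2)] by simp

lemma compact_UNIV_subsequence:
  fixes y :: "nat \<Rightarrow> 'a::metric_space"
  assumes "compact (UNIV :: 'a set)"
  obtains r w where "strict_mono r" "(\<lambda>k. y (r k)) \<longlonglongrightarrow> w"
proof -
  have "\<forall>k. y k \<in> UNIV" by simp
  then show thesis using assms that unfolding compact_def comp_def by blast
qed

section \<open>Stable sets and orbit closures within the classes\<close>

text \<open>The orbit of \<open>y\<close> can switch to the orbit of \<open>z\<close> at a late time \<open>k\<close> and then follow any chain back to
\<open>z\<close>. The orbit of \<open>z\<close> followed by the same chain back is a cycle of the same length, so the gcd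
divides that length.\<close>

lemma chain_rel_asymptotic:
  assumes "chain_transitive f" "(\<lambda>k. dist ((f ^^ k) y) ((f ^^ k) z)) \<longlonglongrightarrow> 0"
  shows "(y, z) \<in> chain_rel f"
  unfolding chain_rel_iff
proof (intro allI impI)
  fix \<delta> :: real assume \<delta>: "0 < \<delta>"
  have "\<forall>\<^sub>F k in sequentially. dist ((f ^^ k) y) ((f ^^ k) z) < \<delta> / 2 \<and> 0 < k"
    using order_tendstoD(2)[OF assms(2), of "\<delta> / 2"] \<delta>
    by (intro eventually_conj eventually_gt_at_top) simp
  then obtain k where k: "dist ((f ^^ k) y) ((f ^^ k) z) < \<delta> / 2" "0 < k"
    by (auto dest: eventually_happens)
  have y: "reach f \<delta> k y ((f ^^ k) z)"
    using reach_perturb_end[of f \<delta> k y "(f ^^ k) y"] reach_orbit[of k "\<delta> / 2" f y] k \<delta> by auto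
  obtain l where l: "reach f \<delta> l ((f ^^ k) z) z"
    using chain_transitive_reach assms(1) \<delta> by metis
  have "reach f \<delta> (k + l) z z" using reach_trans[OF reach_orbit l] k \<delta> by simp
  then show "\<exists>k. reach f \<delta> k y z \<and> cycle_gcd f \<delta> dvd k"
    using reach_trans[OF y l] cycle_gcd_dvd by blast
qed

text \<open>A chain from \<open>x\<close> that reaches \<open>f\<^sup>L z\<close> at exactly the time \<open>L\<close>, continued by the exact orbit of \<open>z\<close>, is
a limit pseudo orbit, and the point shadowing it is close to \<open>x\<close> and asymptotic to \<open>z\<close>. The
synchronisation of the times matters: it keeps the shadowing point in the class of \<open>z\<close> at all
scales, although only one scale is controlled by the chain. Since \<open>x\<close> and \<open>z\<close> are related, chains of
every large length \<open>m t\<close> lead from \<open>x\<close> to \<open>(f ^^ (m * r k0)) z\<close>; a target time which is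
itself large enough comes from a convergent subsequence of the iterates of \<open>f\<^sup>m\<close> at \<open>z\<close>.\<close>

lemma stable_set_dense_in_class:
  fixes f :: "'a::metric_space \<Rightarrow> 'a"
  assumes "compact (UNIV :: 'a set)" "chain_transitive f" "s_limit_shadowing f"
    and xz: "(x, z) \<in> chain_rel f" and "0 < \<epsilon>"
  obtains y where "dist y x \<le> \<epsilon>" "(\<lambda>k. dist ((f ^^ k) y) ((f ^^ k) z)) \<longlonglongrightarrow> 0"
proof -
  obtain \<delta> where \<delta>: "0 < \<delta>" and
    shadow: "\<And>x. limit_pseudo_orbit f \<delta> x \<Longrightarrow> \<exists>p. limit_shadowed_by f \<epsilon> x p"
    using assms unfolding s_limit_shadowing_def by blast
  define m where "m = cycle_gcd f (\<delta> / 2)"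
  obtain w r where r: "strict_mono r" and lim: "(\<lambda>k. (f ^^ (m * r k)) z) \<longlonglongrightarrow> w"
    using compact_UNIV_subsequence[OF assms(1), of "\<lambda>k. (f ^^ (m * k)) z"] by blast
  have "Cauchy (\<lambda>k. (f ^^ (m * r k)) z)"
    using lim by (rule LIMSEQ_imp_Cauchy)
  then obtain k0 where k0:
      "\<And>k. k0 \<le> k \<Longrightarrow> dist ((f ^^ (m * r k0)) z) ((f ^^ (m * r k)) z) < \<delta> / 2"
    using metric_CauchyD[of _ "\<delta> / 2"] \<delta> by (metis half_gt_zero order_refl)
  obtain k where "reach f (\<delta> / 2) k x z" "m dvd k"
    using xz half_gt_zero[OF \<delta>] unfolding chain_rel_iff m_def by blast
  then have "(x, (f ^^ (m * r k0)) z) \<in> chain_rel_at f (\<delta> / 2)"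
    using reach_orbit_extend[of f "\<delta> / 2" k x z "m * r k0"] \<delta>
    by (auto simp: chain_rel_at_iff m_def)
  then obtain t0 where
    t0: "\<And>t. t0 \<le> t \<Longrightarrow> reach f (\<delta> / 2) (m * t) x ((f ^^ (m * r k0)) z)"
    using reach_large_multiples assms(2) \<delta> m_def by (metis half_gt_zero)
  \<comment> \<open>\<open>max k0 t0\<close> makes \<open>f\<^sup>L z\<close> close to the fixed target and \<open>L\<close> a length for which a chain exists.\<close>
  define L where "L = m * r (max k0 t0)"
  have "t0 \<le> r (max k0 t0)"
    using seq_suble[OF r, of "max k0 t0"] by simp
  then have "reach f \<delta> L x ((f ^^ L) z)"
    unfolding L_def using reach_perturb_end[OF t0 less_imp_le[OF k0]] by simp
  then obtain c where c: "delta_chain f \<delta> L c" "c 0 = x" "c L = (f ^^ L) z"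
    by (auto simp: reach_def)
  define \<xi> where "\<xi> i = (if i < L then c i else (f ^^ i) z)" for i
  have "dist (f (\<xi> i)) (\<xi> (Suc i)) \<le> \<delta>" for i
  proof (cases "i < L")
    case True
    then have "\<xi> (Suc i) = c (Suc i)" using c by (cases "Suc i = L") (auto simp: \<xi>_def)
    with True c show ?thesis by (auto simp: delta_chain_def \<xi>_def)
  qed (use \<delta> in \<open>simp add: \<xi>_def\<close>)
  moreover have "(\<lambda>i. dist (f (\<xi> i)) (\<xi> (Suc i))) \<longlonglongrightarrow> 0"
    by (intro tendsto_eventually eventually_sequentiallyI[of L]) (simp add: \<xi>_def)
  ultimately obtain p where p: "limit_shadowed_by f \<epsilon> \<xi> p"
    using shadow by (auto simp: limit_pseudo_orbit_def)
  have "dist p x \<le> \<epsilon>"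
    using p[unfolded limit_shadowed_by_def, THEN conjunct1, rule_format, of 0] c
    by (simp add: \<xi>_def delta_chain_def)
  moreover have "(\<lambda>k. dist ((f ^^ k) p) ((f ^^ k) z)) \<longlonglongrightarrow> 0"
  proof (rule Lim_transform_eventually)
    show "(\<lambda>k. dist ((f ^^ k) p) (\<xi> k)) \<longlonglongrightarrow> 0"
      using p by (simp add: limit_shadowed_by_def)
    show "\<forall>\<^sub>F k in sequentially. dist ((f ^^ k) p) (\<xi> k) = dist ((f ^^ k) p) ((f ^^ k) z)"
      by (intro eventually_sequentiallyI[of L]) (simp add: \<xi>_def)
  qed
  ultimately show thesis using that by blast
qed

text \<open>At a single scale some iterate of \<open>z\<close> is related to \<open>x\<close>, because the length of a chain from \<open>x\<close> to \<open>z\<close>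
can be completed to a multiple of the gcd by following the orbit of \<open>z\<close>. A limit point of these
iterates, as the scale shrinks, is related to \<open>x\<close> at all scales.\<close>

lemma orbit_closure_meets_class:
  fixes f :: "'a::metric_space \<Rightarrow> 'a"
  assumes "compact (UNIV :: 'a set)" "chain_transitive f"
  obtains w s where "(x, w) \<in> chain_rel f" "(\<lambda>l. (f ^^ s l) z) \<longlonglongrightarrow> w"
proof -
  have "\<exists>j. (x, (f ^^ j) z) \<in> chain_rel_at f (inverse (Suc l))" for l
  proof -
    let ?\<delta> = "inverse (real (Suc l))"
    obtain k where k: "reach f ?\<delta> k x z"
      using chain_transitive_reach assms(2) by (metis inverse_positive_iff_positive of_nat_0_less_iff zero_less_Suc)
    obtain m where m: "cycle_gcd f ?\<delta> = Suc m"
      using cycle_gcd_pos[OF assms(2), of ?\<delta>] gr0_implies_Suc by auto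
    have "reach f ?\<delta> (k + m * k) x ((f ^^ (m * k)) z)"
      using reach_orbit_extend[OF k] by simp
    then show ?thesis
      unfolding chain_rel_at_iff m by (metis dvd_triv_left mult_Suc)
  qed
  then obtain j where j: "\<And>l. (x, (f ^^ j l) z) \<in> chain_rel_at f (inverse (Suc l))"
    by metis
  obtain w r where r: "strict_mono r" and lim: "(\<lambda>l. (f ^^ j (r l)) z) \<longlonglongrightarrow> w"
    using compact_UNIV_subsequence[OF assms(1), of "\<lambda>l. (f ^^ j l) z"] by blast
  have "(x, w) \<in> chain_rel f"
  proof (rule chain_rel_limit[OF assms(2) lim])
    fix \<delta> :: real assume "0 < \<delta>"
    then obtain l0 where l0: "inverse (Suc l0) < \<delta>" using reals_Archimedean by blast
    show "\<forall>\<^sub>F l in sequentially. (x, (f ^^ j (r l)) z) \<in> chain_rel_at f \<delta>"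
    proof (rule eventually_sequentiallyI[of l0])
      fix l assume "l0 \<le> l"
      then have "l0 \<le> r l" using seq_suble[OF r, of l] by simp
      then have "inverse (real (Suc (r l))) \<le> inverse (real (Suc l0))"
        by (intro le_imp_inverse_le) auto
      then have "inverse (real (Suc (r l))) \<le> \<delta>" using l0 by linarith
      then show "(x, (f ^^ j (r l)) z) \<in> chain_rel_at f \<delta>"
        by (rule chain_rel_at_mono[OF j[of "r l"]])
    qed
  qed
  then show thesis using that[of w "\<lambda>l. j (r l)"] lim by simp
qed

section \<open>Separated orbits from positive entropy\<close>

text \<open>Ordinary shadowing follows from s-limit shadowing by compactness: an initial segment of a
pseudo orbit, continued by an exact orbit, is a limit pseudo orbit.\<close>

lemma pseudo_orbit_shadowing:
  fixes f :: "'a::metric_space \<Rightarrow> 'a"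
  assumes "compact (UNIV :: 'a set)" "continuous_on UNIV f" "s_limit_shadowing f" "0 < \<epsilon>"
  obtains \<delta> where "0 < \<delta>"
    "\<And>x. (\<And>i. dist (f (x i)) (x (Suc i)) \<le> \<delta>) \<Longrightarrow> \<exists>p. \<forall>i. dist ((f ^^ i) p) (x i) \<le> \<epsilon>"
proof -
  obtain \<delta> where \<delta>: "0 < \<delta>" and
    shadow: "\<And>x. limit_pseudo_orbit f \<delta> x \<Longrightarrow> \<exists>p. limit_shadowed_by f \<epsilon> x p"
    using assms unfolding s_limit_shadowing_def by blast
  have "\<exists>p. \<forall>i. dist ((f ^^ i) p) (x i) \<le> \<epsilon>"
    if x: "\<And>i. dist (f (x i)) (x (Suc i)) \<le> \<delta>" for x
  proof -
    have "\<exists>p. \<forall>i\<le>l. dist ((f ^^ i) p) (x i) \<le> \<epsilon>" for l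
    proof -
      define \<xi> where "\<xi> i = (if i \<le> l then x i else (f ^^ (i - l)) (x l))" for i
      have step: "f (\<xi> i) = \<xi> (Suc i)" if "l \<le> i" for i
        using that by (auto simp: \<xi>_def Suc_diff_le)
      have "dist (f (\<xi> i)) (\<xi> (Suc i)) \<le> \<delta>" for i
        using x[of i] step[of i] \<delta> by (cases "l \<le> i") (auto simp: \<xi>_def)
      moreover have "(\<lambda>i. dist (f (\<xi> i)) (\<xi> (Suc i))) \<longlonglongrightarrow> 0"
        by (intro tendsto_eventually eventually_sequentiallyI[of l]) (simp add: step)
      ultimately obtain p where "limit_shadowed_by f \<epsilon> \<xi> p"
        using shadow by (auto simp: limit_pseudo_orbit_def)
      then have "dist ((f ^^ i) p) (\<xi> i) \<le> \<epsilon>" for i by (simp add: limit_shadowed_by_def)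
      then have "\<forall>i\<le>l. dist ((f ^^ i) p) (x i) \<le> \<epsilon>" by (metis \<xi>_def)
      then show ?thesis by blast
    qed
    then obtain p where p: "\<And>l i. i \<le> l \<Longrightarrow> dist ((f ^^ i) (p l)) (x i) \<le> \<epsilon>" by metis
    obtain q r where r: "strict_mono r" and lim: "(\<lambda>l. p (r l)) \<longlonglongrightarrow> q"
      using compact_UNIV_subsequence[OF assms(1)] by blast
    have "dist ((f ^^ i) q) (x i) \<le> \<epsilon>" for i
    proof (rule tendsto_upperbound)
      show "(\<lambda>l. dist ((f ^^ i) (p (r l))) (x i)) \<longlonglongrightarrow> dist ((f ^^ i) q) (x i)"
        by (intro tendsto_intros tendsto_funpow assms lim)
      show "\<forall>\<^sub>F l in sequentially. dist ((f ^^ i) (p (r l))) (x i) \<le> \<epsilon>"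
        using p order_trans[OF _ seq_suble[OF r]] by (intro eventually_sequentiallyI[of i]) blast
    qed simp
    then show ?thesis by blast
  qed
  then show thesis using that \<delta> by blast
qed

text \<open>If the lengths were unbounded, a sequence of pairs with longer and longer chains would accumulate at
some pair \<open>(p, q)\<close>; a single chain at scale \<open>\<delta> / 3\<close> from \<open>p\<close> to \<open>q\<close> serves all nearby pairs at scale \<open>\<delta>\<close>.\<close>

lemma uniform_chain_length:
  fixes f :: "'a::metric_space \<Rightarrow> 'a"
  assumes "compact (UNIV :: 'a set)" "continuous_on UNIV f" "chain_transitive f" "0 < \<delta>"
  obtains K where "\<And>p q. \<exists>l\<le>K. reach f \<delta> l p q"
proof -
  have "\<exists>K. \<forall>p q. \<exists>l\<le>K. reach f \<delta> l p q"
  proof (rule ccontr)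
    assume "\<nexists>K. \<forall>p q. \<exists>l\<le>K. reach f \<delta> l p q"
    then obtain P Q where PQ: "\<And>K l. l \<le> K \<Longrightarrow> \<not> reach f \<delta> l (P K) (Q K)" by metis
    have "compact (UNIV \<times> UNIV :: ('a \<times> 'a) set)" using assms(1) compact_Times by blast
    then obtain s r where r: "strict_mono r" and lim: "(\<lambda>k. (P (r k), Q (r k))) \<longlonglongrightarrow> s"
      using compact_UNIV_subsequence[of "\<lambda>k. (P k, Q k)"] by auto
    obtain p q where s: "s = (p, q)" by (cases s)
    have P: "(\<lambda>k. f (P (r k))) \<longlonglongrightarrow> f p" and Q: "(\<lambda>k. Q (r k)) \<longlonglongrightarrow> q"
      using tendsto_fst[OF lim] tendsto_snd[OF lim] tendsto_funpow[OF assms(2), of "\<lambda>k. P (r k)" p 1]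
      by (auto simp: s)
    obtain l where l: "reach f (\<delta> / 3) l p q"
      using chain_transitive_reach assms by (metis divide_pos_pos zero_less_numeral)
    have "\<forall>\<^sub>F k in sequentially. dist (f (P (r k))) (f p) < \<delta> / 3"
      "\<forall>\<^sub>F k in sequentially. dist (Q (r k)) q < \<delta> / 3" "\<forall>\<^sub>F k in sequentially. l \<le> k"
      by (use assms(4) in \<open>intro tendstoD[OF P] tendstoD[OF Q] eventually_ge_at_top; simp\<close>)+
    then have "\<forall>\<^sub>F k in sequentially. False"
    proof eventually_elim
      case (elim k)
      then have "reach f (\<delta> / 3 + \<delta> / 3 + \<delta> / 3) l (P (r k)) (Q (r k))"
        using assms(4) by (intro reach_perturb[OF l]) (auto simp: dist_commute)
      then show ?case using PQ[of l "r k"] seq_suble[OF r, of k] elim by simp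
    qed
    then show False by simp
  qed
  then show thesis using that by blast
qed

lemma periodic_pseudo_orbit:
  assumes "0 < N" "reach f \<delta> l ((f ^^ N) x) x" "0 \<le> \<delta>"
  obtains c where "\<And>t. dist (f (c t)) (c (Suc t)) \<le> \<delta>" "\<And>t. c t = c (t mod (N + l))"
    "\<And>t. t < N \<Longrightarrow> c t = (f ^^ t) x"
proof -
  obtain u where u: "delta_chain f \<delta> l u" "u 0 = (f ^^ N) x" "u l = x"
    using assms by (auto simp: reach_def)
  then have l: "0 < l" by (simp add: delta_chain_def)
  \<comment> \<open>The orbit segment of length \<open>N\<close>, followed by the chain back to \<open>x\<close>, and then read cyclically.\<close>
  define e where "e s = (if s < N then (f ^^ s) x else u (s - N))" for s
  define c where "c t = e (t mod (N + l))" for t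
  have "dist (f (c t)) (c (Suc t)) \<le> \<delta>" for t
  proof -
    define s where "s = t mod (N + l)"
    have "s < N + l" using l by (simp add: s_def)
    have e: "dist (f (e s)) (e (Suc s)) \<le> \<delta>"
    proof (cases "s < N")
      case True
      then have "e (Suc s) = (f ^^ Suc s) x"
        using u(2) by (cases "Suc s = N") (auto simp: e_def)
      with True assms(3) show ?thesis by (simp add: e_def)
    next
      case False
      with u(1) \<open>s < N + l\<close> show ?thesis by (auto simp: e_def delta_chain_def Suc_diff_le)
    qed
    have "c (Suc t) = e (Suc s)"
      using u(3) assms(1) by (auto simp: c_def s_def mod_Suc e_def)
    with e show ?thesis by (simp add: c_def s_def)
  qed
  then show thesis using that[of c] l by (simp add: c_def e_def)
qed

text \<open>Think of \<open>B y\<close> as the set of points that are forbidden once \<open>y\<close> has been chosen.\<close>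

lemma greedy_choice:
  assumes "finite E" "n * M < card E" "\<And>y. y \<in> E \<Longrightarrow> finite (B y) \<and> card (B y) \<le> M"
  obtains x where "\<And>i. i < n \<Longrightarrow> x i \<in> E" "\<And>i j. i < n \<Longrightarrow> j < i \<Longrightarrow> x i \<notin> B (x j)"
proof -
  have "\<exists>x. \<forall>i<n. x i \<in> E \<and> (\<forall>j<i. x i \<notin> B (x j))"
    using assms(2)
  proof (induction n)
    case (Suc n)
    then obtain x where x: "\<forall>i<n. x i \<in> E \<and> (\<forall>j<i. x i \<notin> B (x j))" by auto
    have "card (\<Union>j\<in>{..<n}. B (x j)) \<le> (\<Sum>j\<in>{..<n}. card (B (x j)))"
      by (rule card_UN_le) simp
    also have "\<dots> \<le> (\<Sum>j\<in>{..<n}. M)"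
      using x assms(3) by (intro sum_mono) auto
    also have "\<dots> < card E" using Suc.prems by simp
    finally have "\<not> E \<subseteq> (\<Union>j\<in>{..<n}. B (x j))"
      using x assms(3) card_mono[of "\<Union>j\<in>{..<n}. B (x j)" E] by (auto simp: not_less[symmetric])
    then obtain e where "e \<in> E" "\<forall>j<n. e \<notin> B (x j)" by auto
    with x show ?case by (intro exI[of _ "x(n := e)"]) (auto simp: less_Suc_eq)
  qed simp
  then show thesis using that by blast
qed

lemma iterates_equicontinuous:
  fixes f :: "'a::metric_space \<Rightarrow> 'a"
  assumes "compact (UNIV :: 'a set)" "continuous_on UNIV f" "0 < \<epsilon>"
  obtains \<eta> where "0 < \<eta>"
    "\<And>p q t. dist p q < \<eta> \<Longrightarrow> t \<le> T \<Longrightarrow> dist ((f ^^ t) p) ((f ^^ t) q) < \<epsilon>"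
proof -
  have "\<exists>\<eta>>0. \<forall>p q. dist p q < \<eta> \<longrightarrow> (\<forall>t\<le>T. dist ((f ^^ t) p) ((f ^^ t) q) < \<epsilon>)"
  proof (induction T)
    case 0
    then show ?case using assms(3) by auto
  next
    case (Suc T)
    then obtain \<eta> where \<eta>: "0 < \<eta>"
      "\<And>p q t. dist p q < \<eta> \<Longrightarrow> t \<le> T \<Longrightarrow> dist ((f ^^ t) p) ((f ^^ t) q) < \<epsilon>" by blast
    have "uniformly_continuous_on UNIV (f ^^ Suc T)"
      using compact_uniformly_continuous[OF continuous_on_funpow[OF assms(2)] assms(1)] .
    then obtain \<theta> where \<theta>: "0 < \<theta>"
      "\<And>p q. dist p q < \<theta> \<Longrightarrow> dist ((f ^^ Suc T) p) ((f ^^ Suc T) q) < \<epsilon>"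
      using uniformly_continuous_onE[of UNIV "f ^^ Suc T" \<epsilon>] assms(3) by (metis UNIV_I)
    have "dist ((f ^^ t) p) ((f ^^ t) q) < \<epsilon>" if "dist p q < min \<eta> \<theta>" "t \<le> Suc T" for p q t
      using \<eta>(2)[of p q t] \<theta>(2)[of p q] that by (cases "t = Suc T") auto
    then show ?case using \<eta>(1) \<theta>(1) by (intro exI[of _ "min \<eta> \<theta>"]) simp
  qed
  then show thesis using that by blast
qed

lemma limsup_greater_beyond:
  fixes g :: "nat \<Rightarrow> ereal"
  assumes "c < limsup g" shows "\<exists>n\<ge>n0. c < g n"
proof (rule ccontr)
  assume "\<not> ?thesis"
  then have "\<forall>\<^sub>F n in sequentially. g n \<le> c"
    by (intro eventually_sequentiallyI[of n0]) (auto simp: not_less)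
  then have "limsup g \<le> c" by (rule Limsup_bounded)
  with assms show False by simp
qed

text \<open>The counting argument below needs separated sets that are large compared with a linear function
of the time \<open>N\<close>; exponential growth along a subsequence of times provides them.\<close>

lemma positive_entropy_many_separated:
  fixes f :: "'a::metric_space \<Rightarrow> 'a"
  assumes "0 < h_top f"
  obtains \<epsilon> where "0 < \<epsilon>"
    "\<And>n K. \<exists>N>0. \<exists>E. finite E \<and> separated f N \<epsilon> E \<and> n * (N + K) < card E"
proof -
  obtain \<epsilon> where \<epsilon>: "0 < \<epsilon>" "0 < limsup (\<lambda>n. log_sep f n \<epsilon> / ereal (real n))"
    using assms by (auto simp: h_top_def less_SUP_iff)
  then obtain c where c: "0 < c" "ereal c < limsup (\<lambda>n. log_sep f n \<epsilon> / ereal (real n))"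
    using ereal_dense2[OF \<epsilon>(2)] by (auto simp: zero_ereal_def)
  have "\<exists>N>0. \<exists>E. finite E \<and> separated f N \<epsilon> E \<and> n * (N + K) < card E" for n K :: nat
  proof -
    \<comment> \<open>\<open>exp (c N) \<ge> (c N / 2)\<^sup>2\<close> exceeds \<open>2 n N \<ge> n (N + K)\<close> as soon as \<open>N > 8 n / c\<^sup>2\<close> and \<open>N \<ge> K\<close>.\<close>
    define n0 where "n0 = Suc (max K (nat \<lceil>8 * n / c\<^sup>2\<rceil>))"
    obtain N where N: "n0 \<le> N" "ereal c < log_sep f N \<epsilon> / ereal (real N)"
      using limsup_greater_beyond[OF c(2)] by blast
    have N0: "0 < N" "K \<le> N" "8 * n / c\<^sup>2 < N" using N(1) unfolding n0_def by linarith+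
    have "ereal (c * N) < log_sep f N \<epsilon>"
      using N(2) N0 by (simp add: ereal_less_divide_iff)
    then obtain E where E: "finite E" "separated f N \<epsilon> E" "c * N < ln (card E)"
      by (auto simp: log_sep_def less_SUP_iff)
    have "real n * 8 < c\<^sup>2 * N" using N0(3) c(1) by (simp add: field_simps)
    then have "real n * 8 * N < c\<^sup>2 * N * N" using N0(1) by simp
    moreover have "real n * (N + K) \<le> real n * (N + N)" using N0(2) by (intro mult_left_mono) auto
    ultimately have "real n * (N + K) < (c * N / 2)\<^sup>2"
      by (simp add: power2_eq_square algebra_simps)
    also have "\<dots> \<le> (exp (c * N / 2))\<^sup>2"
    proof (rule power_mono)
      show "c * N / 2 \<le> exp (c * N / 2)" using exp_ge_add_one_self[of "c * N / 2"] by linarith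
    qed (use c(1) in simp)
    also have "\<dots> = exp (c * N)" by (simp flip: exp_double)
    also have "\<dots> < card E"
    proof -
      have "0 < card E" using E(3) c(1) N0(1) by (cases "card E = 0") (auto simp: mult_less_0_iff)
      then show ?thesis using E(3) by (metis exp_less_mono exp_ln of_nat_0_less_iff)
    qed
    finally have "n * (N + K) < card E" by (metis of_nat_add of_nat_less_iff of_nat_mult)
    with E N0 show ?thesis by blast
  qed
  then show thesis using that \<epsilon> by blast
qed

text \<open>Each point of a large separated set \<open>E\<close> is closed up to a periodic pseudo orbit, whose first \<open>N\<close>
entries are the true orbit, and whose period is at most \<open>N + K\<close> with \<open>K\<close> independent of \<open>N\<close>. A
periodic sequence with period \<open>L\<close> has only \<open>L\<close> shifts, and each shift stays close during \<open>N\<close> steps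
to at most one point of \<open>E\<close>. So each choice excludes at most \<open>N + K\<close> points of \<open>E\<close>, and \<open>n\<close> points can
be chosen such that their pseudo orbits separate within bounded time after any shift of
either one. The shadowing points inherit this, and uniform continuity turns a separation within
bounded time into a separation at time 0, for all pairs of points of two different orbits.\<close>

lemma separated_orbits:
  fixes f :: "'a::metric_space \<Rightarrow> 'a"
  assumes "compact (UNIV :: 'a set)" "continuous_on UNIV f" "chain_transitive f"
    "s_limit_shadowing f" "0 < h_top f"
  shows "\<exists>\<eta>>0. \<exists>z. \<forall>i<n::nat. \<forall>j<i. \<forall>a b. \<eta> \<le> dist ((f ^^ a) (z i)) ((f ^^ b) (z j))"
proof -
  obtain \<epsilon> where \<epsilon>: "0 < \<epsilon>" and many:
    "\<And>n K. \<exists>N>0. \<exists>E. finite E \<and> separated f N \<epsilon> E \<and> n * (N + K) < card E"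
    using positive_entropy_many_separated[OF assms(5)] by metis
  obtain \<delta> where \<delta>: "0 < \<delta>" and shadow:
    "\<And>x. (\<And>i. dist (f (x i)) (x (Suc i)) \<le> \<delta>) \<Longrightarrow> \<exists>p. \<forall>i. dist ((f ^^ i) p) (x i) \<le> \<epsilon> / 8"
    using pseudo_orbit_shadowing[OF assms(1,2,4), of "\<epsilon> / 8"] \<epsilon> by auto
  obtain K where K: "\<And>p q. \<exists>l\<le>K. reach f \<delta> l p q"
    using uniform_chain_length[OF assms(1-3) \<delta>] by blast
  obtain N E where N: "0 < N" and E: "finite E" "separated f N \<epsilon> E" "n * (N + K) < card E"
    using many by blast
  have "\<exists>c L. 0 < L \<and> L \<le> N + K \<and> (\<forall>t. dist (f (c t)) (c (Suc t)) \<le> \<delta>) \<and>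
      (\<forall>t. c t = c (t mod L)) \<and> (\<forall>t<N. c t = (f ^^ t) x)" for x
  proof -
    obtain l where l: "l \<le> K" "reach f \<delta> l ((f ^^ N) x) x" using K by blast
    show ?thesis
      using periodic_pseudo_orbit[OF N l(2) less_imp_le[OF \<delta>]] N l(1)
      by (metis add_gr_0 add_left_mono)
  qed
  then obtain c L where
    L: "\<And>x. 0 < L x" "\<And>x. L x \<le> N + K" and
    c: "\<And>x t. dist (f (c x t)) (c x (Suc t)) \<le> \<delta>" and
    per: "\<And>x t. c x t = c x (t mod L x)" and
    init: "\<And>x t. t < N \<Longrightarrow> c x t = (f ^^ t) x" by metis
  obtain s where s: "\<And>x i. dist ((f ^^ i) (s x)) (c x i) \<le> \<epsilon> / 8"
  proof -
    have "\<exists>p. \<forall>i. dist ((f ^^ i) p) (c x i) \<le> \<epsilon> / 8" for x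
      using c by (rule shadow)
    then show ?thesis using that by metis
  qed
  define near where
    "near y j = {x \<in> E. \<forall>t<N. dist ((f ^^ t) x) (c y (j + t)) \<le> \<epsilon> / 2}" for y j
  have near: "card (near y j) \<le> 1" for y j
  proof -
    have "x = x'" if x: "x \<in> near y j" "x' \<in> near y j" for x x'
    proof (rule ccontr)
      assume "x \<noteq> x'"
      then obtain t where t: "t < N" "dist ((f ^^ t) x) ((f ^^ t) x') > \<epsilon>"
        using E(2) x unfolding separated_def near_def by blast
      have "dist ((f ^^ t) x) (c y (j + t)) \<le> \<epsilon> / 2" "dist ((f ^^ t) x') (c y (j + t)) \<le> \<epsilon> / 2"
        using x t(1) by (auto simp: near_def)
      then show False using t(2) dist_triangle2[of "(f ^^ t) x" "(f ^^ t) x'" "c y (j + t)"] by linarith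
    qed
    then show ?thesis using E(1) card_le_Suc0_iff_eq[of "near y j"] by (simp add: near_def)
  qed
  define B where "B y = (\<Union>j<L y. near y j)" for y
  have "finite (B y) \<and> card (B y) \<le> N + K" for y
  proof
    show "finite (B y)" using E(1) by (auto simp: B_def near_def)
    have "card (B y) \<le> (\<Sum>j<L y. card (near y j))" unfolding B_def by (rule card_UN_le) simp
    also have "\<dots> \<le> (\<Sum>j<L y. 1)" by (intro sum_mono near)
    also have "\<dots> \<le> N + K" using L(2) by simp
    finally show "card (B y) \<le> N + K" .
  qed
  then obtain x where x: "\<And>i. i < n \<Longrightarrow> x i \<in> E" "\<And>i j. i < n \<Longrightarrow> j < i \<Longrightarrow> x i \<notin> B (x j)"
    using greedy_choice[OF E(1,3), of B] by metis
  \<comment> \<open>Waiting for a new period takes at most \<open>N + K\<close> steps, the separation at most \<open>N\<close> more; and \<open>\<epsilon> / 8 + \<epsilon> / 4 + \<epsilon> / 8 = \<epsilon> / 2\<close>.\<close>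
  obtain \<eta> where \<eta>: "0 < \<eta>" "\<And>p q t. dist p q < \<eta> \<Longrightarrow> t \<le> 2 * N + K \<Longrightarrow>
      dist ((f ^^ t) p) ((f ^^ t) q) < \<epsilon> / 4"
    using iterates_equicontinuous[OF assms(1,2), of "\<epsilon> / 4" "2 * N + K"] \<epsilon> by auto
  have "\<eta> \<le> dist ((f ^^ a) (s (x i))) ((f ^^ b) (s (x j)))" if ij: "i < n" "j < i" for i j a b
  proof (rule ccontr)
    assume close: "\<not> ?thesis"
    define u v where "u = x i" and "v = x j"
    \<comment> \<open>At time \<open>a + t0\<close> the pseudo orbit of \<open>u\<close> starts a new period, hence follows the orbit of \<open>u\<close> for \<open>N\<close> steps.\<close>
    define t0 where "t0 = L u - a mod L u"
    define r where "r = (b + t0) mod L v"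
    have "a + t0 = L u * Suc (a div L u)"
      using mod_less_divisor[OF L(1), of a u] mult_div_mod_eq[of "L u" a]
      unfolding t0_def mult_Suc_right by linarith
    then have "(a + t0 + t) mod L u = t mod L u" for t by (metis mod_mult_self4)
    then have cu: "c u (a + t0 + t) = c u t" for t
      using per by metis
    have cv: "c v (b + t0 + t) = c v (r + t)" for t
      using per[of v "b + t0 + t"] per[of v "r + t"] by (simp add: r_def mod_add_left_eq)
    have "r < L v" using L(1) by (simp add: r_def)
    then have "u \<notin> near v r" using x(2)[OF ij] by (auto simp: B_def u_def v_def)
    then obtain t where t: "t < N" "dist ((f ^^ t) u) (c v (r + t)) > \<epsilon> / 2"
      using x(1)[OF ij(1)] by (auto simp: near_def u_def not_le)
    have far: "dist (c u (a + t0 + t)) (c v (b + t0 + t)) > \<epsilon> / 2"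
      using t init by (simp add: cu cv)
    have "t0 + t \<le> 2 * N + K" using t(1) L(2)[of u] by (simp add: t0_def)
    then have "dist ((f ^^ (t0 + t)) ((f ^^ a) (s u))) ((f ^^ (t0 + t)) ((f ^^ b) (s v))) < \<epsilon> / 4"
      using close by (intro \<eta>(2)) (auto simp: u_def v_def)
    then have "dist ((f ^^ (a + t0 + t)) (s u)) ((f ^^ (b + t0 + t)) (s v)) < \<epsilon> / 4"
      by (metis add.assoc add.commute comp_apply funpow_add)
    moreover have "dist ((f ^^ (a + t0 + t)) (s u)) (c u (a + t0 + t)) \<le> \<epsilon> / 8"
      "dist ((f ^^ (b + t0 + t)) (s v)) (c v (b + t0 + t)) \<le> \<epsilon> / 8" using s by blast+
    ultimately show False using far by metric
  qed
  then show ?thesis using \<eta>(1) by (intro exI[of _ \<eta>] conjI exI[of _ "\<lambda>i. s (x i)"]) auto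
qed

text \<open>Since the orbits of the \<open>z i\<close> are apart at all pairs of times, the points of their closures that lie
in the class of \<open>x\<close> may be taken independently of each other.\<close>

lemma separated_tuple_in_class:
  fixes f :: "'a::metric_space \<Rightarrow> 'a"
  assumes "compact (UNIV :: 'a set)" "continuous_on UNIV f" "chain_transitive f"
    and z: "\<forall>i<n. \<forall>j<i. \<forall>a b. \<eta> \<le> dist ((f ^^ a) (z i)) ((f ^^ b) (z j))"
  shows "\<exists>w. (\<forall>i. (x, w i) \<in> chain_rel f) \<and>
    (\<forall>i<n. \<forall>j<i. \<forall>k. \<eta> \<le> dist ((f ^^ k) (w i)) ((f ^^ k) (w j)))"
proof -
  have "\<exists>v r. (x, v) \<in> chain_rel f \<and> (\<lambda>l. (f ^^ r l) (z i)) \<longlonglongrightarrow> v" for i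
    by (rule orbit_closure_meets_class[OF assms(1,3), of x "z i"]) blast
  then obtain w s where w: "\<And>i. (x, w i) \<in> chain_rel f"
    and lim: "\<And>i. (\<lambda>l. (f ^^ s i l) (z i)) \<longlonglongrightarrow> w i"
    by metis
  have "\<eta> \<le> dist ((f ^^ k) (w i)) ((f ^^ k) (w j))" if "i < n" "j < i" for i j k
  proof (rule tendsto_lowerbound)
    show "(\<lambda>l. dist ((f ^^ k) ((f ^^ s i l) (z i))) ((f ^^ k) ((f ^^ s j l) (z j))))
        \<longlonglongrightarrow> dist ((f ^^ k) (w i)) ((f ^^ k) (w j))"
      by (intro tendsto_dist tendsto_funpow assms lim)
    have "(f ^^ k) ((f ^^ a) p) = (f ^^ (k + a)) p" for a p by (simp add: funpow_add)
    then show "\<forall>\<^sub>F l in sequentially. \<eta> \<le> dist ((f ^^ k) ((f ^^ s i l) (z i))) ((f ^^ k) ((f ^^ s j l) (z j)))"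
      using z that by simp
  qed simp
  with w show ?thesis by blast
qed

section \<open>Upper density one is a residual property\<close>

lemma upper_density_le_1: "upper_density P \<le> 1"
proof -
  have "ereal (real (card {k. k < m \<and> P k}) / real m) \<le> 1" for m
  proof -
    have "card {k. k < m \<and> P k} \<le> card {..<m}" by (intro card_mono) auto
    then show ?thesis by (cases "m = 0") auto
  qed
  then show ?thesis
    unfolding upper_density_def by (intro Limsup_bounded always_eventually) auto
qed

lemma upper_density_mono:
  assumes "\<And>k. P k \<Longrightarrow> Q k"
  shows "upper_density P \<le> upper_density Q"
  unfolding upper_density_def
proof (intro Limsup_mono always_eventually allI)
  fix m
  have "card {k. k < m \<and> P k} \<le> card {k. k < m \<and> Q k}"
    using assms by (intro card_mono) auto
  then show "ereal (real (card {k. k < m \<and> P k}) / real m) \<le> ereal (real (card {k. k < m \<and> Q k}) / real m)"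
    by (simp add: divide_right_mono)
qed

text \<open>For each \<open>m\<close> the inequality concerns finitely many times only. So if \<open>P\<close> depends on a point by open
conditions, this criterion describes a \<open>G\<^sub>\<delta>\<close> set of points.\<close>

lemma upper_density_eq_1I:
  assumes "\<And>q N. \<exists>m\<ge>N. 0 < m \<and> (1 - inverse (real (Suc q))) * real m < real (card {k. k < m \<and> P k})"
  shows "upper_density P = 1"
proof (rule antisym[OF upper_density_le_1])
  let ?d = "\<lambda>m. ereal (real (card {k. k < m \<and> P k}) / real m)"
  show "1 \<le> upper_density P"
  proof (rule ccontr)
    assume "\<not> ?thesis"
    then obtain c where c: "upper_density P < ereal c" "ereal c < 1"
      using ereal_dense2 by (metis not_le)
    then have "c < 1" by (simp add: one_ereal_def)
    then obtain q where q: "inverse (real (Suc q)) < 1 - c" using reals_Archimedean[of "1 - c"] by auto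
    obtain N where N: "\<And>m. N \<le> m \<Longrightarrow> ?d m < ereal c"
      using Limsup_lessD[OF c(1)[unfolded upper_density_def]] unfolding eventually_sequentially by blast
    obtain m where m: "N \<le> m" "0 < m" "(1 - inverse (real (Suc q))) * real m < card {k. k < m \<and> P k}"
      using assms by blast
    have "c * m \<le> (1 - inverse (real (Suc q))) * m" using q by (intro mult_right_mono) auto
    with m have "c * m < card {k. k < m \<and> P k}" by linarith
    moreover have "card {k. k < m \<and> P k} < c * m"
      using N[OF m(1)] m(2) by (simp add: field_simps)
    ultimately show False by simp
  qed
qed

lemma eventually_density_near_1:
  fixes c :: real
  assumes "eventually P sequentially" "c < 1"
  shows "\<exists>m\<ge>N. 0 < m \<and> c * real m < card {k. k < m \<and> P k}"
proof -
  obtain M where M: "\<And>k. M \<le> k \<Longrightarrow> P k" using assms(1) by (auto simp: eventually_sequentially)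
  obtain m0 where m0: "M / (1 - c) < real m0" using reals_Archimedean2 by blast
  define m where "m = Suc (max N m0)"
  have "M / (1 - c) < m" using m0 by (simp add: m_def)
  then have "M < (1 - c) * m" using assms(2) by (simp add: field_simps)
  then have "c * m < real m - M" by (simp add: algebra_simps)
  also have "\<dots> \<le> card {M..<m}" by simp
  also have "card {M..<m} \<le> card {k. k < m \<and> P k}"
    by (intro card_mono) (auto simp: M)
  finally show ?thesis by (intro exI[of _ m]) (auto simp: m_def)
qed

lemma openin_count_greater:
  assumes "\<And>k. openin T {x \<in> topspace T. P x k}"
  shows "openin T {x \<in> topspace T. r < real (card {k. k < (m::nat) \<and> P x k})}"
proof -
  let ?F = "{F. F \<subseteq> {..<m} \<and> r < card F}"
  have "{x \<in> topspace T. r < real (card {k. k < m \<and> P x k})} =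
      (\<Union>F\<in>?F. topspace T \<inter> \<Inter> ((\<lambda>k. {x \<in> topspace T. P x k}) ` F))" (is "?l = ?r")
  proof (intro equalityI subsetI)
    fix x assume "x \<in> ?l"
    then show "x \<in> ?r" by (intro UN_I[of "{k. k < m \<and> P x k}"]) auto
  next
    fix x assume "x \<in> ?r"
    then obtain F where F: "F \<subseteq> {..<m}" "r < card F" "x \<in> topspace T" "\<forall>k\<in>F. P x k" by auto
    then have "card F \<le> card {k. k < m \<and> P x k}" by (intro card_mono) auto
    with F show "x \<in> ?l" by simp
  qed
  moreover have "openin T (topspace T \<inter> \<Inter> ((\<lambda>k. {x \<in> topspace T. P x k}) ` F))" if "F \<in> ?F" for F
    using that assms finite_subset[of F "{..<m}"]
    by (cases "F = {}") (auto intro!: openin_Int openin_Inter)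
  then have "openin T ?r" by (intro openin_Union) blast
  ultimately show ?thesis by (simp only:)
qed

text \<open>Each condition \<open>P i\<close> is open at every time and holds from some time on for a dense set of points.
So each of the sets \<open>U (i, q, N)\<close>, on which it holds with frequency above \<open>1 - 1 / (q + 1)\<close> up to some
time \<open>m \<ge> N\<close>, is open and dense, and the Baire category theorem applies to their intersection.\<close>

lemma residual_upper_density_one:
  fixes P :: "'i::countable \<Rightarrow> 'b \<Rightarrow> nat \<Rightarrow> bool"
  assumes "compact_space T" "Hausdorff_space T"
    and opn: "\<And>i k. openin T {x \<in> topspace T. P i x k}"
    and S: "\<And>i. S i \<subseteq> topspace T" "\<And>i. T closure_of S i = topspace T"
    and ev: "\<And>i x. x \<in> S i \<Longrightarrow> eventually (P i x) sequentially"
  shows "residual_in T {x \<in> topspace T. \<forall>i. upper_density (P i x) = 1}"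
proof -
  define c where "c q = 1 - inverse (real (Suc q))" for q
  have c1: "c q < 1" for q by (simp add: c_def)
  define U where "U = (\<lambda>(i, q, N). {x \<in> topspace T.
      \<exists>m\<ge>N. 0 < m \<and> c q * real m < card {k. k < m \<and> P i x k}})"
  have "openin T (U (i, q, N)) \<and> T closure_of (U (i, q, N)) = topspace T" for i q N
  proof
    have "U (i, q, N) = (\<Union>m\<in>{m. N \<le> m \<and> 0 < m}.
        {x \<in> topspace T. c q * real m < card {k. k < m \<and> P i x k}})"
      by (auto simp: U_def)
    then show "openin T (U (i, q, N))"
      using openin_count_greater[OF opn] by auto
    have "S i \<subseteq> U (i, q, N)"
      using S(1)[of i] eventually_density_near_1[OF ev c1, of _ i N q] by (auto simp: U_def)
    then show "T closure_of (U (i, q, N)) = topspace T"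
      using closure_of_mono[of "S i" "U (i, q, N)" T] S(2)[of i]
        closure_of_subset_topspace[of T "U (i, q, N)"] by blast
  qed
  then have U: "openin T V \<and> T closure_of V = topspace T" if "V \<in> range U" for V
    using that by auto
  have "T closure_of \<Inter>(range U) = topspace T"
    using assms(1,2) U
    by (intro Baire_category)
      (auto simp: compact_imp_locally_compact_space compact_Hausdorff_imp_regular_space)
  moreover have "gdelta_in T (\<Inter>(range U))"
    using U by (intro gdelta_in_Inter) (auto intro: open_imp_gdelta_in)
  moreover have "\<Inter>(range U) \<subseteq> {x \<in> topspace T. \<forall>i. upper_density (P i x) = 1}"
  proof
    fix x assume "x \<in> \<Inter>(range U)"
    then have x: "x \<in> U (i, q, N)" for i q N by blast
    then have "upper_density (P i x) = 1" for i
      by (intro upper_density_eq_1I) (use x[of i] in \<open>auto simp: U_def c_def\<close>)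
    moreover have "x \<in> topspace T" using x[of undefined 0 0] by (simp add: U_def)
    ultimately show "x \<in> {x \<in> topspace T. \<forall>i. upper_density (P i x) = 1}" by simp
  qed
  ultimately show ?thesis unfolding residual_in_def by blast
qed

section \<open>Distances within tuples\<close>

lemma pair_dists_image:
  "pair_dists f n x k =
    (\<lambda>(i, j). dist ((f ^^ k) (x i)) ((f ^^ k) (x j))) ` {(i, j). i < j \<and> j < n}"
  by (auto simp: pair_dists_def)

lemma
  assumes "2 \<le> n"
  shows finite_pair_dists: "finite (pair_dists f n x k)"
    and pair_dists_nonempty: "pair_dists f n x k \<noteq> {}"
proof -
  have "{(i, j). i < j \<and> j < n} \<subseteq> {..<n} \<times> {..<n}" by auto
  then show "finite (pair_dists f n x k)"
    unfolding pair_dists_image by (intro finite_imageI) (rule finite_subset, auto)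
  have "(0, 1) \<in> {(i, j). i < j \<and> j < n}" using assms by auto
  then show "pair_dists f n x k \<noteq> {}" unfolding pair_dists_image by blast
qed

lemma Max_pair_dists_less_iff:
  assumes "2 \<le> n"
  shows "Max (pair_dists f n x k) < \<epsilon> \<longleftrightarrow>
    (\<forall>j<n. \<forall>i<j. dist ((f ^^ k) (x i)) ((f ^^ k) (x j)) < \<epsilon>)"
  unfolding Max_less_iff[OF finite_pair_dists[OF assms] pair_dists_nonempty[OF assms]]
  by (auto simp: pair_dists_image)

lemma Min_pair_dists_greater_iff:
  assumes "2 \<le> n"
  shows "\<delta> < Min (pair_dists f n x k) \<longleftrightarrow>
    (\<forall>j<n. \<forall>i<j. \<delta> < dist ((f ^^ k) (x i)) ((f ^^ k) (x j)))"
  unfolding Min_gr_iff[OF finite_pair_dists[OF assms] pair_dists_nonempty[OF assms]]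
  by (auto simp: pair_dists_image)

lemma openin_power_top_pairs:
  fixes f :: "'a::metric_space \<Rightarrow> 'a" and A :: "real set"
  assumes "continuous_on UNIV f" "open A"
  shows "openin (power_top n D) {x \<in> topspace (power_top n D).
    \<forall>j<n. \<forall>i<j. dist ((f ^^ k) (x i)) ((f ^^ k) (x j)) \<in> A}"
proof -
  let ?T = "power_top n D"
  have coord: "continuous_map ?T euclidean (\<lambda>x. (f ^^ k) (x i))" if "i < n" for i
  proof -
    have "continuous_map ?T (top_of_set D) (\<lambda>x. x i)"
      unfolding power_top_def using that by (intro continuous_map_product_projection) auto
    moreover have "continuous_map (top_of_set D) euclidean (f ^^ k)"
      using continuous_on_subset[OF continuous_on_funpow[OF assms(1)]] by simp
    ultimately show ?thesis
      using continuous_map_compose unfolding comp_def by blast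
  qed
  have "openin ?T {x \<in> topspace ?T. dist ((f ^^ k) (x i)) ((f ^^ k) (x j)) \<in> A}"
    if "i < j" "j < n" for i j
  proof -
    have "continuous_map ?T euclideanreal (\<lambda>x. dist ((f ^^ k) (x i)) ((f ^^ k) (x j)))"
    proof -
      have "continuous_map ?T (prod_topology euclidean euclidean) (\<lambda>x. ((f ^^ k) (x i), (f ^^ k) (x j)))"
        using that by (intro continuous_map_pairedI coord) linarith+
      moreover have "continuous_on UNIV (\<lambda>p::'a \<times> 'a. dist (fst p) (snd p))"
        by (intro continuous_intros)
      ultimately show ?thesis
        using continuous_map_compose[of ?T euclidean "\<lambda>x. ((f ^^ k) (x i), (f ^^ k) (x j))"
            euclideanreal "\<lambda>p. dist (fst p) (snd p)"]
        by (simp add: comp_def)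
    qed
    then show ?thesis
      using openin_continuous_map_preimage[of ?T euclideanreal _ A] assms(2) by simp
  qed
  then have "openin ?T (topspace ?T \<inter> (\<Inter>j\<in>{..<n}. topspace ?T \<inter> (\<Inter>i\<in>{..<j}.
      {x \<in> topspace ?T. dist ((f ^^ k) (x i)) ((f ^^ k) (x j)) \<in> A})))"
    by (intro openin_Int_Inter) (auto intro!: openin_Int_Inter)
  also have "topspace ?T \<inter> (\<Inter>j\<in>{..<n}. topspace ?T \<inter> (\<Inter>i\<in>{..<j}.
      {x \<in> topspace ?T. dist ((f ^^ k) (x i)) ((f ^^ k) (x j)) \<in> A})) =
      {x \<in> topspace ?T. \<forall>j<n. \<forall>i<j. dist ((f ^^ k) (x i)) ((f ^^ k) (x j)) \<in> A}"
    by auto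
  finally show ?thesis .
qed

section \<open>Residual sets of scrambled tuples\<close>

text \<open>The points asymptotic to \<open>z\<close> that approximate a point of the class \<open>D\<close> lie in \<open>D\<close> themselves.\<close>

lemma stable_set_closure:
  fixes f :: "'a::metric_space \<Rightarrow> 'a"
  assumes "compact (UNIV :: 'a set)" "chain_transitive f" "s_limit_shadowing f"
    and "D \<in> chain_classes f" "z \<in> D"
  shows "top_of_set D closure_of {y \<in> D. (\<lambda>k. dist ((f ^^ k) y) ((f ^^ k) z)) \<longlonglongrightarrow> 0} = D"
    (is "_ closure_of ?W = D")
proof (intro equalityI subsetI)
  fix x assume "x \<in> D"
  obtain x0 where D: "D = chain_rel f `` {x0}"
    using assms(4) by (auto simp: chain_classes_def elim: quotientE)
  have xz: "(x, z) \<in> chain_rel f"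
    using D \<open>x \<in> D\<close> assms(5) chain_rel_sym[OF assms(2)] chain_rel_trans by blast
  have "\<exists>y\<in>?W. y \<in> U" if U: "openin (top_of_set D) U" "x \<in> U" for U
  proof -
    obtain V where V: "open V" "U = D \<inter> V" using U by (auto simp: openin_open)
    then obtain e where e: "0 < e" "cball x e \<subseteq> V"
      using U(2) open_contains_cball by blast
    obtain y where y: "dist y x \<le> e" "(\<lambda>k. dist ((f ^^ k) y) ((f ^^ k) z)) \<longlonglongrightarrow> 0"
      using stable_set_dense_in_class[OF assms(1-3) xz e(1)] by blast
    have "(z, y) \<in> chain_rel f"
      using chain_rel_asymptotic[OF assms(2) y(2)] chain_rel_sym[OF assms(2)] by blast
    then have "y \<in> D" using D assms(5) chain_rel_trans by blast
    moreover have "y \<in> V" using y(1) e(2) by (auto simp: dist_commute)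
    ultimately show ?thesis using y(2) V(2) by auto
  qed
  then show "x \<in> top_of_set D closure_of ?W" using \<open>x \<in> D\<close> by (auto simp: in_closure_of)
qed (use closure_of_subset_topspace in force)

lemma eventually_pairs:
  assumes "\<And>i j :: nat. j < n \<Longrightarrow> i < j \<Longrightarrow> eventually (Q i j) F"
  shows "eventually (\<lambda>k. \<forall>j<n. \<forall>i<j. Q i j k) F"
proof -
  have "eventually (\<lambda>k. \<forall>j\<in>{..<n}. \<forall>i\<in>{..<j}. Q i j k) F"
    using assms by (intro eventually_ball_finite ballI) auto
  then show ?thesis by (simp add: Ball_def)
qed

lemma eventually_Max_pair_dists_less:
  fixes f :: "'a::metric_space \<Rightarrow> 'a" and y :: "nat \<Rightarrow> 'a"
  assumes "2 \<le> n" "0 < \<epsilon>"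
    and lim: "\<And>i. i < n \<Longrightarrow> (\<lambda>k. dist ((f ^^ k) (y i)) ((f ^^ k) z)) \<longlonglongrightarrow> 0"
  shows "\<forall>\<^sub>F k in sequentially. Max (pair_dists f n y k) < \<epsilon>"
  unfolding Max_pair_dists_less_iff[OF assms(1)]
proof (rule eventually_pairs)
  fix i j assume ij: "j < n" "i < j"
  have "(\<lambda>k. dist ((f ^^ k) (y i)) ((f ^^ k) z) + dist ((f ^^ k) (y j)) ((f ^^ k) z)) \<longlonglongrightarrow> 0 + 0"
    using ij by (intro tendsto_add lim) auto
  then have "\<forall>\<^sub>F k in sequentially.
      dist ((f ^^ k) (y i)) ((f ^^ k) z) + dist ((f ^^ k) (y j)) ((f ^^ k) z) < \<epsilon>"
    using assms(2) by (intro order_tendstoD(2)) auto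
  then show "\<forall>\<^sub>F k in sequentially. dist ((f ^^ k) (y i)) ((f ^^ k) (y j)) < \<epsilon>"
    by eventually_elim (rule le_less_trans[OF dist_triangle2])
qed

lemma eventually_Min_pair_dists_greater:
  fixes f :: "'a::metric_space \<Rightarrow> 'a" and y :: "nat \<Rightarrow> 'a"
  assumes "2 \<le> n" "0 < \<eta>"
    and lim: "\<And>i. i < n \<Longrightarrow> (\<lambda>k. dist ((f ^^ k) (y i)) ((f ^^ k) (w i))) \<longlonglongrightarrow> 0"
    and w: "\<forall>i<n. \<forall>j<i. \<forall>k. \<eta> \<le> dist ((f ^^ k) (w i)) ((f ^^ k) (w j))"
  shows "\<forall>\<^sub>F k in sequentially. \<eta> / 2 < Min (pair_dists f n y k)"
  unfolding Min_pair_dists_greater_iff[OF assms(1)]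
proof (rule eventually_pairs)
  fix i j assume ij: "j < n" "i < j"
  have "(\<lambda>k. dist ((f ^^ k) (y i)) ((f ^^ k) (w i)) + dist ((f ^^ k) (y j)) ((f ^^ k) (w j))) \<longlonglongrightarrow> 0 + 0"
    using ij by (intro tendsto_add lim) auto
  then have "\<forall>\<^sub>F k in sequentially.
      dist ((f ^^ k) (y i)) ((f ^^ k) (w i)) + dist ((f ^^ k) (y j)) ((f ^^ k) (w j)) < \<eta> / 2"
    using assms(2) by (intro order_tendstoD(2)) auto
  then show "\<forall>\<^sub>F k in sequentially. \<eta> / 2 < dist ((f ^^ k) (y i)) ((f ^^ k) (y j))"
  proof eventually_elim
    case (elim k)
    moreover have "\<eta> \<le> dist ((f ^^ k) (w j)) ((f ^^ k) (w i))" using w ij by blast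
    ultimately show ?case by metric
  qed
qed

lemma residual_in_mono:
  assumes "residual_in T A" "A \<subseteq> B" "B \<subseteq> topspace T"
  shows "residual_in T B"
  using assms unfolding residual_in_def by blast

theorem corollary1p1:
  fixes f :: "'a::metric_space \<Rightarrow> 'a"
  assumes "compact (UNIV :: 'a set)"
    and "continuous_on UNIV f"
    and "chain_transitive f"
    and "s_limit_shadowing f"
    and "h_top f > 0"
  shows "\<forall>n\<ge>2. \<exists>\<delta>>0. \<forall>D\<in>chain_classes f.
    residual_in (power_top n D) (({..<n} \<rightarrow>\<^sub>E D) \<inter> DC1 n \<delta> f)"
proof (intro allI impI)
  fix n :: nat assume n: "2 \<le> n"
  obtain \<eta> z where \<eta>: "0 < \<eta>" and
    z: "\<forall>i<n. \<forall>j<i. \<forall>a b. \<eta> \<le> dist ((f ^^ a) (z i)) ((f ^^ b) (z j))"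
    using separated_orbits[OF assms, of n] by blast
  have "residual_in (power_top n D) (({..<n} \<rightarrow>\<^sub>E D) \<inter> DC1 n (\<eta> / 2) f)"
    if D: "D \<in> chain_classes f" for D
  proof -
    let ?T = "power_top n D"
    obtain x where x: "D = chain_rel f `` {x}"
      using D by (auto simp: chain_classes_def elim: quotientE)
    obtain w where w: "\<forall>i. (x, w i) \<in> chain_rel f"
      "\<forall>i<n. \<forall>j<i. \<forall>k. \<eta> \<le> dist ((f ^^ k) (w i)) ((f ^^ k) (w j))"
      using separated_tuple_in_class[OF assms(1-3) z, of x] by blast
    have wD: "w i \<in> D" for i using w(1) by (simp add: x)
    have xD: "x \<in> D" using chain_rel_refl[OF assms(3)] by (simp add: x)
    have "closed D" unfolding x by (rule closed_chain_class[OF assms(3)])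
    then have "compact D" using compact_Int_closed[OF assms(1)] by simp
    then have T: "compact_space ?T" "Hausdorff_space ?T"
      by (simp_all add: power_top_def compact_space_product_topology compact_space_subtopology
          Hausdorff_space_product_topology Hausdorff_space_subtopology)
    have top: "topspace ?T = {..<n} \<rightarrow>\<^sub>E D" by (simp add: power_top_def)
    \<comment> \<open>The tuples asymptotic to \<open>u\<close>: dense in the power of \<open>D\<close>, whichever tuple \<open>u\<close> in \<open>D\<close> is chosen.\<close>
    define W where "W u = (\<Pi>\<^sub>E i\<in>{..<n}.
        {y \<in> D. (\<lambda>k. dist ((f ^^ k) y) ((f ^^ k) (u i))) \<longlonglongrightarrow> 0})" for u
    have W: "W u \<subseteq> topspace ?T" "?T closure_of W u = topspace ?T" if "\<And>i. u i \<in> D" for u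
    proof -
      show "W u \<subseteq> topspace ?T" unfolding W_def top by (intro PiE_mono) auto
      show "?T closure_of W u = topspace ?T"
        unfolding top unfolding W_def power_top_def closure_of_product_topology
        using stable_set_closure[OF assms(1,3,4) D that] by simp
    qed
    have lim: "(\<lambda>k. dist ((f ^^ k) (y i)) ((f ^^ k) (u i))) \<longlonglongrightarrow> 0"
      if "y \<in> W u" "i < n" for y u i
      using that by (auto simp: W_def PiE_iff)
    \<comment> \<open>\<open>None\<close> stands for separation, \<open>Some m\<close> for proximity up to \<open>1 / (m + 1)\<close>.\<close>
    define P where "P q y k = (case q of
        None \<Rightarrow> \<eta> / 2 < Min (pair_dists f n y k)
      | Some m \<Rightarrow> Max (pair_dists f n y k) < inverse (real (Suc m)))" for q y k
    have P: "P None y = (\<lambda>k. \<eta> / 2 < Min (pair_dists f n y k))"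
      "P (Some m) y = (\<lambda>k. Max (pair_dists f n y k) < inverse (real (Suc m)))" for m y
      by (auto simp: P_def)
    \<comment> \<open>Asymptotic to a constant tuple gives proximity, asymptotic to the separated tuple \<open>w\<close> gives separation.\<close>
    define S where "S q = (case q of None \<Rightarrow> W w | Some (m::nat) \<Rightarrow> W (\<lambda>_. x))" for q
    have "residual_in ?T {y \<in> topspace ?T. \<forall>q. upper_density (P q y) = 1}"
    proof (rule residual_upper_density_one[OF T, of P S])
      show "openin ?T {y \<in> topspace ?T. P q y k}" for q k
        using openin_power_top_pairs[OF assms(2), of "{\<eta> / 2<..}" n D k]
          openin_power_top_pairs[OF assms(2), of "{..<inverse (real (Suc (the q)))}" n D k]
        by (cases q) (simp_all add: P_def Min_pair_dists_greater_iff[OF n] Max_pair_dists_less_iff[OF n])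
      show "S q \<subseteq> topspace ?T" "?T closure_of S q = topspace ?T" for q
        using W[of w] W[of "\<lambda>_. x"] wD xD by (cases q; simp add: S_def)+
      show "eventually (P q y) sequentially" if y: "y \<in> S q" for q y
      proof (cases q)
        case None
        then show ?thesis
          unfolding None P using lim[of y w] y w(2) None
          by (intro eventually_Min_pair_dists_greater[OF n \<eta>, of f y w]) (auto simp: S_def)
      next
        case (Some m)
        then show ?thesis
          unfolding Some P using lim[of y "\<lambda>_. x"] y Some
          by (intro eventually_Max_pair_dists_less[OF n, of _ f y x]) (auto simp: S_def)
      qed
    qed
    moreover have "{y \<in> topspace ?T. \<forall>q. upper_density (P q y) = 1}
        \<subseteq> ({..<n} \<rightarrow>\<^sub>E D) \<inter> DC1 n (\<eta> / 2) f"
    proof clarify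
      fix y assume y: "y \<in> topspace ?T" and dens: "\<forall>q. upper_density (P q y) = 1"
      have "upper_density (\<lambda>k. Max (pair_dists f n y k) < \<epsilon>) = 1" if \<epsilon>: "0 < \<epsilon>" for \<epsilon>
      proof (rule antisym[OF upper_density_le_1])
        obtain m where m: "inverse (real (Suc m)) < \<epsilon>" using reals_Archimedean[OF \<epsilon>] by auto
        have "1 = upper_density (P (Some m) y)" using dens by simp
        also have "\<dots> \<le> upper_density (\<lambda>k. Max (pair_dists f n y k) < \<epsilon>)"
          unfolding P using m by (intro upper_density_mono) auto
        finally show "1 \<le> upper_density (\<lambda>k. Max (pair_dists f n y k) < \<epsilon>)" .
      qed
      moreover have "upper_density (\<lambda>k. \<eta> / 2 < Min (pair_dists f n y k)) = 1"
        using dens[THEN spec, of None] by (simp add: P(1))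
      ultimately show "y \<in> ({..<n} \<rightarrow>\<^sub>E D) \<inter> DC1 n (\<eta> / 2) f"
        using y by (auto simp: top DC1_def PiE_iff)
    qed
    ultimately show ?thesis by (rule residual_in_mono) (simp add: top)
  qed
  then show "\<exists>\<delta>>0. \<forall>D\<in>chain_classes f. residual_in (power_top n D) (({..<n} \<rightarrow>\<^sub>E D) \<inter> DC1 n \<delta> f)"
    using \<eta> by (intro exI[of _ "\<eta> / 2"]) simp
qed

end
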